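(* Let $M_2$ be a timelike non-cylindrical ruled surface with spacelike base curve and timelike ruling in $\mathbb{R}_1^3$, parametrized by $\tilde\varphi_2(u,v)=\vec\beta_2(u)+v\,\vec e_2(u)$, where $\vec\beta_2$ is the striction curve and $\vec e_2$ the unit director curve, under the standing assumptions on $\vec e_2$ and $\vec\beta_2$ given in the context. Let $P=P(u)$ be the distribution parameter of $M_2$. Then the Gaussian curvature $K=K(u,v)$ of $M_2$ is $$K=\frac{P^2}{\left(P^2+v^2\right)^2}.$$
   Context: $\mathbb{R}_1^3$ is $\mathbb{R}^3$ with the Lorentz metric $\langle x,y\rangle=g(x,y)=x_1y_1+x_2y_2-x_3y_3$, and $\|\vec v\|=\sqrt{|\langle \vec v,\vec v\rangle|}$. A vector $\vec v$ is spacelike if $\langle \vec v,\vec v\rangle>0$ or $\vec v=0$, timelike if $\langle \vec v,\vec v\rangle<0$, and null if $\langle \vec v,\vec v\rangle=0$ with $\vec v\neq0$. A curve is spacelike (timelike) if all its velocity vectors are. The Lorentzian product is $\vec v\wedge\vec w=(v_3w_2-v_2w_3,\;v_1w_3-v_3w_1,\;v_1w_2-v_2w_1)$. Ruled surface: a surface parametrized by $\varphi(u,v)=\vec\alpha(u)+v\,\vec\gamma(u)$, $(u,v)\in I\times\mathbb{R}$, with $\vec\alpha,\vec\gamma$ smooth curves in $\mathbb{R}_1^3$ and $\vec\alpha'$ nowhere zero. It is non-cylindrical if $\vec\gamma\wedge\vec\gamma'$ is nowhere zero. Its striction curve is $\vec\beta=\vec\alpha-\frac{\langle\vec\alpha',\vec\gamma'\rangle}{\langle\vec\gamma',\vec\gamma'\rangle}\vec\gamma$.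 A non-cylindrical ruled surface is reparametrized as $\tilde\varphi(u,v)=\vec\beta(u)+v\,\vec e(u)$ with $\|\vec e\|=1$, $\langle\vec\beta',\vec e'\rangle=0$ and $\vec\beta$ the striction curve. A surface is timelike if its induced metric is Lorentzian, i.e. its normal is spacelike. Standing assumptions for $M_2$: $\vec e_2$ is timelike with $\langle\vec e_2,\vec e_2\rangle=-1$; with $\vec n_2=\vec e_2'/\|\vec e_2'\|$ and $\vec\xi_2=\vec e_2\wedge\vec e_2'/\|\vec e_2\wedge\vec e_2'\|$, the frame $\{\vec e_2,\vec n_2,\vec\xi_2\}$ is orthonormal of type {time, space, space}, i.e. $-\langle\vec e_2,\vec e_2\rangle=\langle\vec n_2,\vec n_2\rangle=\langle\vec\xi_2,\vec\xi_2\rangle=1$ and the vectors are mutually orthogonal. The striction curve is spacelike and satisfies $\vec\beta_2'=\sinh\sigma_2\,\vec e_2+\cosh\sigma_2\,\vec\xi_2$ for a smooth function $\sigma_2=\sigma_2(u)$. Distribution parameter: $P=\dfrac{\det(\vec\beta',\vec e,\vec e')}{\langle\vec e',\vec e'\rangle}$ (a function of $u$), with $\det$ the usual determinant in coordinates. Gaussian curvature (the sign convention used here): $K=\dfrac{LM-N^2}{EG-F^2}$, where $E=\langle\tilde\varphi_u,\tilde\varphi_u\rangle$, $F=\langle\tilde\varphi_u,\tilde\varphi_v\rangle$, $G=\langle\tilde\varphi_v,\tilde\varphi_v\rangle$, $L=\langle\tilde\varphi_{uu},\vec\eta\rangle$, $N=\langle\tilde\varphi_{uv},\vec\eta\rangle$,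 $M=\langle\tilde\varphi_{vv},\vec\eta\rangle$, and $\vec\eta=\dfrac{\tilde\varphi_u\wedge\tilde\varphi_v}{\|\tilde\varphi_u\wedge\tilde\varphi_v\|}$ is the unit normal. *)

theory Defs
  imports "HOL-Analysis.Analysis"
begin

definition lorentz_inner :: "real^3 \<Rightarrow> real^3 \<Rightarrow> real"  (infixl "\<bullet>\<^sub>L" 70)
  where "x \<bullet>\<^sub>L y = x$1 * y$1 + x$2 * y$2 - x$3 * y$3"

definition lorentz_norm :: "real^3 \<Rightarrow> real"
  where "lorentz_norm x = sqrt \<bar>x \<bullet>\<^sub>L x\<bar>"

definition lorentz_cross :: "real^3 \<Rightarrow> real^3 \<Rightarrow> real^3"  (infixl "\<times>\<^sub>L" 75)
  where "v \<times>\<^sub>L w =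
    vector [v$3 * w$2 - v$2 * w$3, v$1 * w$3 - v$3 * w$1, v$1 * w$2 - v$2 * w$1]"

definition spacelike :: "real^3 \<Rightarrow> bool"
  where "spacelike x \<longleftrightarrow> x \<bullet>\<^sub>L x > 0 \<or> x = 0"

definition timelike :: "real^3 \<Rightarrow> bool"
  where "timelike x \<longleftrightarrow> x \<bullet>\<^sub>L x < 0"

text \<open>Derivatives are taken within the parameter interval, so that they are one-sided at an
  endpoint belonging to the interval and the usual two-sided ones at interior points.\<close>

definition deriv_on :: "real set \<Rightarrow> (real \<Rightarrow> 'a::real_normed_vector) \<Rightarrow> real \<Rightarrow> 'a"
  where "deriv_on I f u = vector_derivative f (at u within I)"

definition smooth_on :: "real set \<Rightarrow> (real \<Rightarrow> 'a::real_normed_vector) \<Rightarrow> bool"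
  where "smooth_on I f \<longleftrightarrow> (\<forall>k. (deriv_on I ^^ k) f differentiable_on I)"

definition spacelike_curve :: "real set \<Rightarrow> (real \<Rightarrow> real^3) \<Rightarrow> bool"
  where "spacelike_curve I \<alpha> \<longleftrightarrow> (\<forall>u\<in>I. spacelike (deriv_on I \<alpha> u))"

definition ruled_patch :: "(real \<Rightarrow> real^3) \<Rightarrow> (real \<Rightarrow> real^3) \<Rightarrow> real \<Rightarrow> real \<Rightarrow> real^3"
  where "ruled_patch \<alpha> \<gamma> u v = \<alpha> u + v *\<^sub>R \<gamma> u"

definition ruled_surface :: "real set \<Rightarrow> (real \<Rightarrow> real^3) \<Rightarrow> (real \<Rightarrow> real^3) \<Rightarrow> bool"
  where "ruled_surface I \<alpha> \<gamma> \<longleftrightarrow>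
    smooth_on I \<alpha> \<and> smooth_on I \<gamma> \<and> (\<forall>u\<in>I. deriv_on I \<alpha> u \<noteq> 0)"

definition non_cylindrical :: "real set \<Rightarrow> (real \<Rightarrow> real^3) \<Rightarrow> bool"
  where "non_cylindrical I \<gamma> \<longleftrightarrow> (\<forall>u\<in>I. \<gamma> u \<times>\<^sub>L deriv_on I \<gamma> u \<noteq> 0)"

definition striction_curve ::
    "real set \<Rightarrow> (real \<Rightarrow> real^3) \<Rightarrow> (real \<Rightarrow> real^3) \<Rightarrow> real \<Rightarrow> real^3"
  where "striction_curve I \<alpha> \<gamma> u =
    \<alpha> u - ((deriv_on I \<alpha> u \<bullet>\<^sub>L deriv_on I \<gamma> u) / (deriv_on I \<gamma> u \<bullet>\<^sub>L deriv_on I \<gamma> u)) *\<^sub>R \<gamma> u"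

text \<open>The normalized parametrization of a non-cylindrical ruled surface: unit director curve,
  and the base curve is the striction curve of the surface.\<close>

definition striction_parametrization ::
    "real set \<Rightarrow> (real \<Rightarrow> real^3) \<Rightarrow> (real \<Rightarrow> real^3) \<Rightarrow> bool"
  where "striction_parametrization I \<beta> e \<longleftrightarrow>
    (\<forall>u\<in>I. lorentz_norm (e u) = 1 \<and> deriv_on I \<beta> u \<bullet>\<^sub>L deriv_on I e u = 0
      \<and> \<beta> u = striction_curve I \<beta> e u)"

definition distribution_parameter ::
    "real set \<Rightarrow> (real \<Rightarrow> real^3) \<Rightarrow> (real \<Rightarrow> real^3) \<Rightarrow> real \<Rightarrow> real"
  where "distribution_parameter I \<beta> e u =
    det (vector [deriv_on I \<beta> u, e u, deriv_on I e u] :: real^3^3)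
      / (deriv_on I e u \<bullet>\<^sub>L deriv_on I e u)"

definition director_normal :: "real set \<Rightarrow> (real \<Rightarrow> real^3) \<Rightarrow> real \<Rightarrow> real^3"
  where "director_normal I e u = deriv_on I e u /\<^sub>R lorentz_norm (deriv_on I e u)"

definition director_binormal :: "real set \<Rightarrow> (real \<Rightarrow> real^3) \<Rightarrow> real \<Rightarrow> real^3"
  where "director_binormal I e u =
    (e u \<times>\<^sub>L deriv_on I e u) /\<^sub>R lorentz_norm (e u \<times>\<^sub>L deriv_on I e u)"

definition orthonormal_tss :: "real^3 \<Rightarrow> real^3 \<Rightarrow> real^3 \<Rightarrow> bool"
  where "orthonormal_tss a b c \<longleftrightarrow>
    - (a \<bullet>\<^sub>L a) = 1 \<and> b \<bullet>\<^sub>L b = 1 \<and> c \<bullet>\<^sub>L c = 1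
      \<and> a \<bullet>\<^sub>L b = 0 \<and> a \<bullet>\<^sub>L c = 0 \<and> b \<bullet>\<^sub>L c = 0"

text \<open>Patches are maps on \<open>I \<times> UNIV\<close>, so the partial derivative in the second variable is
  unrestricted.\<close>

definition partial_u ::
    "real set \<Rightarrow> (real \<Rightarrow> real \<Rightarrow> real^3) \<Rightarrow> real \<Rightarrow> real \<Rightarrow> real^3"
  where "partial_u I \<phi> u v = deriv_on I (\<lambda>s. \<phi> s v) u"

definition partial_v :: "(real \<Rightarrow> real \<Rightarrow> real^3) \<Rightarrow> real \<Rightarrow> real \<Rightarrow> real^3"
  where "partial_v \<phi> u v = deriv_on UNIV (\<phi> u) v"

text \<open>The tangent plane is spanned by the two partial derivatives; the induced metric is
  Lorentzian when that plane has a Lorentz orthonormal basis of one spacelike and one timelike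
  vector. Such vectors are linearly independent, so the patch is then regular. Equivalently, the
  normal vector \<open>\<phi>\<^sub>u \<times>\<^sub>L \<phi>\<^sub>v\<close> is nonzero and spacelike, since its Lorentz square is \<open>F\<^sup>2 - E * G\<close>.\<close>

definition timelike_surface :: "real set \<Rightarrow> (real \<Rightarrow> real \<Rightarrow> real^3) \<Rightarrow> bool"
  where "timelike_surface I \<phi> \<longleftrightarrow> (\<forall>u\<in>I. \<forall>v. \<exists>p q.
    span {p, q} = span {partial_u I \<phi> u v, partial_v \<phi> u v}
      \<and> p \<bullet>\<^sub>L p = 1 \<and> q \<bullet>\<^sub>L q = -1 \<and> p \<bullet>\<^sub>L q = 0)"

definition unit_normal ::
    "real set \<Rightarrow> (real \<Rightarrow> real \<Rightarrow> real^3) \<Rightarrow> real \<Rightarrow> real \<Rightarrow> real^3"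
  where "unit_normal I \<phi> u v =
    (partial_u I \<phi> u v \<times>\<^sub>L partial_v \<phi> u v)
      /\<^sub>R lorentz_norm (partial_u I \<phi> u v \<times>\<^sub>L partial_v \<phi> u v)"

text \<open>The letters follow the convention in which \<open>N\<close> is the mixed coefficient and \<open>M\<close> the one
  of \<open>\<phi>\<^sub>v\<^sub>v\<close>. No sign factor for the causal character of the normal is included.\<close>

definition gaussian_curvature ::
    "real set \<Rightarrow> (real \<Rightarrow> real \<Rightarrow> real^3) \<Rightarrow> real \<Rightarrow> real \<Rightarrow> real"
  where "gaussian_curvature I \<phi> u v =
    (let \<phi>\<^sub>u = partial_u I \<phi>; \<phi>\<^sub>v = partial_v \<phi>; \<eta> = unit_normal I \<phi> u v;
         E = \<phi>\<^sub>u u v \<bullet>\<^sub>L \<phi>\<^sub>u u v; F = \<phi>\<^sub>u u v \<bullet>\<^sub>L \<phi>\<^sub>v u v; G = \<phi>\<^sub>v u v \<bullet>\<^sub>L \<phi>\<^sub>v u v;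
         L = partial_u I \<phi>\<^sub>u u v \<bullet>\<^sub>L \<eta>; N = partial_v \<phi>\<^sub>u u v \<bullet>\<^sub>L \<eta>; M = partial_v \<phi>\<^sub>v u v \<bullet>\<^sub>L \<eta>
     in (L * M - N\<^sup>2) / (E * G - F\<^sup>2))"

end

theory Submission
  imports Defs
begin

text \<open>Write \<open>a = \<beta>'\<close> and \<open>d = e'\<close> at a fixed parameter \<open>u\<close>. Since the patch is affine in \<open>v\<close>, one has
  \<open>\<phi>\<^sub>u = a + v d\<close>, \<open>\<phi>\<^sub>v = e\<close>, \<open>\<phi>\<^sub>u\<^sub>v = d\<close> and \<open>\<phi>\<^sub>v\<^sub>v = 0\<close>. Thus \<open>M = 0\<close> and
  \<open>K = - N\<^sup>2 / (EG - F\<^sup>2)\<close>, which involves only first derivatives of the two curves. Two identities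
  turn it into a quotient of squares: the triple product \<open>\<langle>x \<and> y, z\<rangle> = - det (x, y, z)\<close>
  (\<open>lorentz_triple_product\<close>) shows that \<open>N\<close> is, up to sign, \<open>det (a, e, d)\<close> divided by the length of the
  normal \<open>w = \<phi>\<^sub>u \<and> \<phi>\<^sub>v\<close>, the term \<open>v d\<close> being lost because \<open>d\<close> occurs twice; and Lagrange's identity
  (\<open>lorentz_lagrange\<close>) says \<open>EG - F\<^sup>2 = - \<langle>w, w\<rangle>\<close>. Hence \<open>K = (det (a, e, d))\<^sup>2 / \<langle>w, w\<rangle>\<^sup>2\<close> wherever \<open>w\<close> is
  spacelike (\<open>gaussian_curvature_ruled_patch\<close>).

  It remains to evaluate both quantities. Let \<open>D = \<langle>d, d\<rangle>\<close>, which is positive because \<open>d\<close> is a multiple of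
  the spacelike unit vector \<open>n\<close>. As \<open>d\<close> is orthogonal to \<open>a\<close> (striction) and to the unit
  timelike vector \<open>e\<close>, one finds \<open>\<langle>w, w\<rangle> = A + v\<^sup>2 D\<close> with \<open>A = \<langle>a, a\<rangle> + \<langle>a, e\<rangle>\<^sup>2\<close>, while the Gram determinant
  (\<open>det_square_eq_lorentz_gram\<close>) gives \<open>(det (a, e, d))\<^sup>2 = D A\<close>. So \<open>P\<^sup>2 = A / D\<close>, and dividing numerator
  and denominator of \<open>D A / (A + v\<^sup>2 D)\<^sup>2\<close> by \<open>D\<^sup>2\<close> yields the formula. The expression of \<open>a\<close> in the frame
  gives \<open>A = (cosh \<sigma>)\<^sup>2 > 0\<close>, so the normal is indeed spacelike.\<close>

lemmas lorentz_defs = lorentz_inner_def lorentz_cross_def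

lemma lorentz_inner_commute: "x \<bullet>\<^sub>L y = y \<bullet>\<^sub>L x"
  by (simp add: lorentz_inner_def mult.commute)

lemma lorentz_inner_add_left: "(x + y) \<bullet>\<^sub>L z = x \<bullet>\<^sub>L z + y \<bullet>\<^sub>L z"
  by (simp add: lorentz_inner_def algebra_simps)

lemma lorentz_inner_add_right: "x \<bullet>\<^sub>L (y + z) = x \<bullet>\<^sub>L y + x \<bullet>\<^sub>L z"
  by (simp add: lorentz_inner_def algebra_simps)

lemma lorentz_inner_scaleR_left: "(c *\<^sub>R x) \<bullet>\<^sub>L y = c * (x \<bullet>\<^sub>L y)"
  by (simp add: lorentz_inner_def algebra_simps)

lemma lorentz_inner_scaleR_right: "x \<bullet>\<^sub>L (c *\<^sub>R y) = c * (x \<bullet>\<^sub>L y)"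
  by (simp add: lorentz_inner_def algebra_simps)

lemma lorentz_inner_zero_left: "0 \<bullet>\<^sub>L x = 0"
  by (simp add: lorentz_inner_def)

lemmas lorentz_inner_bilinear =
  lorentz_inner_add_left lorentz_inner_add_right
  lorentz_inner_scaleR_left lorentz_inner_scaleR_right

text \<open>The Lorentzian product is the Euclidean cross product with the first two coordinates negated,
  that is, minus its reflection in the plane \<open>x\<^sub>3 = 0\<close>; pairing by the Lorentz metric undoes the
  reflection and leaves the sign.\<close>

lemma lorentz_triple_product: "(x \<times>\<^sub>L y) \<bullet>\<^sub>L z = - det (vector [x, y, z] :: real^3^3)"
  by (simp add: lorentz_defs det_3 algebra_simps)

lemma lorentz_lagrange:
  "(x \<times>\<^sub>L y) \<bullet>\<^sub>L (x \<times>\<^sub>L y) = (x \<bullet>\<^sub>L y)\<^sup>2 - (x \<bullet>\<^sub>L x) * (y \<bullet>\<^sub>L y)"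
  by (simp add: lorentz_defs power2_eq_square algebra_simps)

text \<open>If \<open>X\<close> has rows \<open>x, y, z\<close> and \<open>J = diag (1, 1, -1)\<close>, the Gram matrix is \<open>X J X\<^sup>T\<close>, and
  \<open>det J = -1\<close> accounts for the sign.\<close>

lemma det_square_eq_lorentz_gram:
  "(det (vector [x, y, z] :: real^3^3))\<^sup>2 =
    - det (vector [vector [x \<bullet>\<^sub>L x, x \<bullet>\<^sub>L y, x \<bullet>\<^sub>L z],
                   vector [y \<bullet>\<^sub>L x, y \<bullet>\<^sub>L y, y \<bullet>\<^sub>L z],
                   vector [z \<bullet>\<^sub>L x, z \<bullet>\<^sub>L y, z \<bullet>\<^sub>L z]] :: real^3^3)"
  by (simp add: lorentz_inner_def det_3 power2_eq_square algebra_simps)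

text \<open>Derivatives within a set are unique only at its limit points; a nondegenerate interval consists
  of such points, endpoints included, so \<open>deriv_on\<close> obeys the usual rules on all of it.\<close>

lemma interval_point_nontrivial_within:
  fixes I :: "real set"
  assumes "is_interval I" and "interior I \<noteq> {}" and "u \<in> I"
  shows "at u within I \<noteq> bot"
proof -
  have "I \<noteq> {u}"
    using assms(2) by auto
  moreover have "connected I"
    using assms(1) by (simp add: is_interval_connected)
  ultimately show ?thesis
    using assms(3) connected_imp_perfect trivial_limit_within by blast
qed

lemma deriv_on_eqI:
  assumes "at u within I \<noteq> bot" and "(f has_vector_derivative f') (at u within I)"
  shows "deriv_on I f u = f'"
  unfolding deriv_on_def using assms by (rule vector_derivative_within)

lemma has_vector_derivative_deriv_on:
  "f differentiable (at u within I) \<Longrightarrow> (f has_vector_derivative deriv_on I f u) (at u within I)"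
  by (simp add: deriv_on_def vector_derivative_works)

lemma smooth_on_differentiable:
  assumes "smooth_on I f" and "u \<in> I"
  shows "f differentiable (at u within I)"
proof -
  have "(deriv_on I ^^ 0) f differentiable_on I"
    using assms(1) unfolding smooth_on_def by blast
  then show ?thesis
    using assms(2) by (simp add: differentiable_on_def)
qed

lemma deriv_on_UNIV_affine: "deriv_on UNIV (\<lambda>t. p + t *\<^sub>R q) v = q"
  by (rule deriv_on_eqI) (auto intro!: derivative_eq_intros)

lemma partial_u_ruled_patch:
  assumes "at u within I \<noteq> bot"
    and "\<beta> differentiable (at u within I)" and "e differentiable (at u within I)"
  shows "partial_u I (ruled_patch \<beta> e) u v = deriv_on I \<beta> u + v *\<^sub>R deriv_on I e u"
  unfolding partial_u_def ruled_patch_def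
  by (rule deriv_on_eqI[OF assms(1)])
    (auto intro!: derivative_eq_intros has_vector_derivative_deriv_on assms(2,3))

lemma partial_v_ruled_patch: "partial_v (ruled_patch \<beta> e) u v = e u"
  by (simp add: partial_v_def ruled_patch_def[abs_def] deriv_on_UNIV_affine)

text \<open>On any ruled surface with spacelike normal the curvature is nonnegative under the sign
  convention in use: the ruling is an asymptotic direction, so the numerator is minus the square
  of the mixed coefficient, and the denominator \<open>EG - F\<^sup>2\<close> is negative because the tangent plane is
  Lorentzian.\<close>

lemma gaussian_curvature_ruled_patch:
  fixes I :: "real set" and \<beta> e :: "real \<Rightarrow> real^3" and u v :: real
  defines "w \<equiv> (deriv_on I \<beta> u + v *\<^sub>R deriv_on I e u) \<times>\<^sub>L e u"
  assumes nontrivial: "at u within I \<noteq> bot"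
    and diff: "\<beta> differentiable (at u within I)" "e differentiable (at u within I)"
    and spacelike_normal: "w \<bullet>\<^sub>L w > 0"
  shows "gaussian_curvature I (ruled_patch \<beta> e) u v =
    (det (vector [deriv_on I \<beta> u, e u, deriv_on I e u] :: real^3^3))\<^sup>2 / (w \<bullet>\<^sub>L w)\<^sup>2"
proof -
  let ?\<phi> = "ruled_patch \<beta> e"
  let ?a = "deriv_on I \<beta> u" and ?d = "deriv_on I e u"
  let ?W = "w \<bullet>\<^sub>L w" and ?\<Delta> = "det (vector [?a, e u, ?d] :: real^3^3)"
  have \<phi>\<^sub>u: "partial_u I ?\<phi> u t = ?a + t *\<^sub>R ?d" for t
    using partial_u_ruled_patch[OF nontrivial diff] .
  have \<phi>\<^sub>u\<^sub>v: "partial_v (partial_u I ?\<phi>) u v = ?d"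
    by (simp add: partial_v_def \<phi>\<^sub>u[abs_def] deriv_on_UNIV_affine)
  have \<phi>\<^sub>v\<^sub>v: "partial_v (partial_v ?\<phi>) u v = 0"
    using deriv_on_UNIV_affine[of "e u" 0 v]
    by (simp add: partial_v_ruled_patch[abs_def]) (simp add: partial_v_def)
  have \<eta>: "unit_normal I ?\<phi> u v = w /\<^sub>R sqrt ?W"
    using spacelike_normal
    by (simp add: unit_normal_def lorentz_norm_def \<phi>\<^sub>u partial_v_ruled_patch w_def)
  have "w \<bullet>\<^sub>L ?d = - ?\<Delta>"
    unfolding w_def lorentz_triple_product by (simp add: det_3 algebra_simps)
  then have N: "(?d \<bullet>\<^sub>L unit_normal I ?\<phi> u v)\<^sup>2 = ?\<Delta>\<^sup>2 / ?W"
    using spacelike_normal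
    by (simp add: \<eta> lorentz_inner_scaleR_right lorentz_inner_commute[of ?d]
        power_mult_distrib divide_simps)
  have "?W = ((?a + v *\<^sub>R ?d) \<bullet>\<^sub>L e u)\<^sup>2
      - ((?a + v *\<^sub>R ?d) \<bullet>\<^sub>L (?a + v *\<^sub>R ?d)) * (e u \<bullet>\<^sub>L e u)"
    unfolding w_def by (rule lorentz_lagrange)
  then have metric: "((?a + v *\<^sub>R ?d) \<bullet>\<^sub>L (?a + v *\<^sub>R ?d)) * (e u \<bullet>\<^sub>L e u)
      - ((?a + v *\<^sub>R ?d) \<bullet>\<^sub>L e u)\<^sup>2 = - ?W"
    by simp
  have "gaussian_curvature I ?\<phi> u v = - (?\<Delta>\<^sup>2 / ?W) / - ?W"
    by (simp only: gaussian_curvature_def Let_def \<phi>\<^sub>u partial_v_ruled_patch \<phi>\<^sub>u\<^sub>v \<phi>\<^sub>v\<^sub>v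
        lorentz_inner_zero_left N metric) simp
  then show ?thesis
    by (simp add: power2_eq_square[of ?W])
qed

theorem theorem5p1:
  fixes I :: "real set" and \<beta>\<^sub>2 e\<^sub>2 :: "real \<Rightarrow> real^3" and \<sigma>\<^sub>2 :: "real \<Rightarrow> real"
  assumes "is_interval I" and "interior I \<noteq> {}"
    and "ruled_surface I \<beta>\<^sub>2 e\<^sub>2"
    and "non_cylindrical I e\<^sub>2"
    and "striction_parametrization I \<beta>\<^sub>2 e\<^sub>2"
    and "timelike_surface I (ruled_patch \<beta>\<^sub>2 e\<^sub>2)"
    and "spacelike_curve I \<beta>\<^sub>2"
    and "\<forall>u\<in>I. timelike (e\<^sub>2 u) \<and> e\<^sub>2 u \<bullet>\<^sub>L e\<^sub>2 u = -1"
    and "\<forall>u\<in>I. orthonormal_tss (e\<^sub>2 u) (director_normal I e\<^sub>2 u) (director_binormal I e\<^sub>2 u)"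
    and "smooth_on I \<sigma>\<^sub>2"
    and "\<forall>u\<in>I. deriv_on I \<beta>\<^sub>2 u =
      sinh (\<sigma>\<^sub>2 u) *\<^sub>R e\<^sub>2 u + cosh (\<sigma>\<^sub>2 u) *\<^sub>R director_binormal I e\<^sub>2 u"
  shows "\<forall>u\<in>I. \<forall>v. gaussian_curvature I (ruled_patch \<beta>\<^sub>2 e\<^sub>2) u v =
    (distribution_parameter I \<beta>\<^sub>2 e\<^sub>2 u)\<^sup>2 / ((distribution_parameter I \<beta>\<^sub>2 e\<^sub>2 u)\<^sup>2 + v\<^sup>2)\<^sup>2"
proof (intro ballI allI)
  fix u v
  assume u: "u \<in> I"
  let ?a = "deriv_on I \<beta>\<^sub>2 u" and ?e = "e\<^sub>2 u" and ?d = "deriv_on I e\<^sub>2 u"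
  let ?n = "director_normal I e\<^sub>2 u" and ?\<xi> = "director_binormal I e\<^sub>2 u"
  let ?\<Delta> = "det (vector [?a, ?e, ?d] :: real^3^3)"
  let ?w = "(?a + v *\<^sub>R ?d) \<times>\<^sub>L ?e"
  define D where "D = ?d \<bullet>\<^sub>L ?d"
  define A where "A = ?a \<bullet>\<^sub>L ?a + (?a \<bullet>\<^sub>L ?e)\<^sup>2"

  have diff: "\<beta>\<^sub>2 differentiable (at u within I)" "e\<^sub>2 differentiable (at u within I)"
    using assms(3) u by (auto simp: ruled_surface_def intro: smooth_on_differentiable)
  have frame: "?e \<bullet>\<^sub>L ?e = -1" "?n \<bullet>\<^sub>L ?n = 1" "?\<xi> \<bullet>\<^sub>L ?\<xi> = 1" "?e \<bullet>\<^sub>L ?n = 0" "?e \<bullet>\<^sub>L ?\<xi> = 0"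
    using assms(9) u by (auto simp: orthonormal_tss_def)
  have ad: "?a \<bullet>\<^sub>L ?d = 0"
    using assms(5) u by (simp add: striction_parametrization_def)

  \<comment> \<open>A derivative of Lorentz length zero would make the normalized vector zero, since division by
    zero gives zero; so \<open>\<langle>n, n\<rangle> = 1\<close> also excludes null derivatives.\<close>
  have nn: "?n \<bullet>\<^sub>L ?n = D / \<bar>D\<bar>"
    by (simp add: director_normal_def lorentz_norm_def lorentz_inner_bilinear D_def divide_simps)
  then have D: "D > 0"
    using frame(2) by (cases "D > 0") (auto simp: divide_simps split: if_splits)
  then have "?d = sqrt D *\<^sub>R ?n"
    by (simp add: director_normal_def lorentz_norm_def D_def)
  then have ed: "?e \<bullet>\<^sub>L ?d = 0"
    using frame(4) by (metis lorentz_inner_scaleR_right mult_zero_right)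

  have a: "?a = sinh (\<sigma>\<^sub>2 u) *\<^sub>R ?e + cosh (\<sigma>\<^sub>2 u) *\<^sub>R ?\<xi>"
    using assms(11) u by blast
  have "?a \<bullet>\<^sub>L ?e = - sinh (\<sigma>\<^sub>2 u)"
    by (simp add: a lorentz_inner_bilinear frame lorentz_inner_commute[of ?\<xi>])
  moreover have "?a \<bullet>\<^sub>L ?a = (cosh (\<sigma>\<^sub>2 u))\<^sup>2 - (sinh (\<sigma>\<^sub>2 u))\<^sup>2"
    by (simp add: a lorentz_inner_bilinear frame lorentz_inner_commute[of ?\<xi> ?e] power2_eq_square)
  ultimately have "A = (cosh (\<sigma>\<^sub>2 u))\<^sup>2"
    by (simp add: A_def)
  then have A: "A > 0"
    by simp

  have da: "?d \<bullet>\<^sub>L ?a = 0" and de: "?d \<bullet>\<^sub>L ?e = 0"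
    using ad ed by (simp_all add: lorentz_inner_commute)
  have W: "?w \<bullet>\<^sub>L ?w = A + v\<^sup>2 * D"
    by (simp add: lorentz_lagrange lorentz_inner_bilinear frame ad da de A_def D_def
        power2_eq_square)
  have W_pos: "A + v\<^sup>2 * D > 0"
    using A D by (simp add: add_pos_nonneg)
  have \<Delta>: "?\<Delta>\<^sup>2 = D * A"
    unfolding det_square_eq_lorentz_gram
    by (simp add: det_3 frame ad da ed de A_def D_def
        lorentz_inner_commute[of ?e ?a] power2_eq_square algebra_simps)
  have P: "(distribution_parameter I \<beta>\<^sub>2 e\<^sub>2 u)\<^sup>2 = A / D"
    using D by (simp add: distribution_parameter_def power_divide \<Delta> power2_eq_square[of D] flip: D_def)

  have "gaussian_curvature I (ruled_patch \<beta>\<^sub>2 e\<^sub>2) u v = D * A / (A + v\<^sup>2 * D)\<^sup>2"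
    using gaussian_curvature_ruled_patch[OF interval_point_nontrivial_within[OF assms(1,2) u] diff,
        of v] W_pos
    by (simp only: W \<Delta>)
  also have "A + v\<^sup>2 * D = D * (A / D + v\<^sup>2)"
    using D by (simp add: field_simps)
  also have "D * A / (D * (A / D + v\<^sup>2))\<^sup>2 = (A / D) / (A / D + v\<^sup>2)\<^sup>2"
    using D by (simp add: power_mult_distrib power2_eq_square[of D])
  finally show "gaussian_curvature I (ruled_patch \<beta>\<^sub>2 e\<^sub>2) u v =
      (distribution_parameter I \<beta>\<^sub>2 e\<^sub>2 u)\<^sup>2 / ((distribution_parameter I \<beta>\<^sub>2 e\<^sub>2 u)\<^sup>2 + v\<^sup>2)\<^sup>2"
    by (simp only: P)
qed

end
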